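(* Let $m\ge2$ be an integer and let $\alpha_0,\dots,\alpha_{m-1}$ be nonnegative reals with $\sum_{i=0}^{m-1}\alpha_i=1$. Let $D$ be a nonempty Hausdorff topological space, let $Z$ be a real Banach space, and let $f\colon D\to Z$ be an injective mapping such that $\operatorname{ran}f=f(D)$ is convex. Let $(y_0,\dots,y_{m-1})\in D^m$ and consider the recurrence $$(\forall n\ge m)\quad y_n=f^{-1}\big(\alpha_{m-1}f(y_{n-1})+\cdots+\alpha_0f(y_{n-m})\big).$$ Then the following hold: (i) The sequence $(y_n)_{n\in\mathbb N}$ is well defined, and the sequence $(f(y_n))_{n\in\mathbb N}$ lies in the compact convex set $\operatorname{conv}\{f(y_0),\dots,f(y_{m-1})\}$. (ii) Suppose that the Basic Hypothesis (see context) holds and that $f^{-1}$ is continuous from $f(D)$ to $D$. Then $(y_n)_{n\in\mathbb N}$ converges in $D$ and $$\lim_{n\to\infty}y_n=f^{-1}\Big(\sum_{k=0}^{m-1}\lambda_kf(y_k)\Big)=f^{-1}\Big(\frac{\sum_{k=0}^{m-1}a_kf(y_k)}{\sum_{k=0}^{m-1}a_k}\Big)=f^{-1}\Big(\frac{\sum_{k=0}^{m-1}\sum_{i=0}^k\alpha_if(y_k)}{\sum_{k=0}^{m-1}\sum_{i=0}^k\alpha_i}\Big).$$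
   Context: For $k\in\{0,\dots,m-1\}$: $a_k=\sum_{i=0}^k\alpha_i$ and $\lambda_k=a_k/\sum_{i=0}^{m-1}a_i$. Here $f^{-1}\colon f(D)\to D$ is the inverse of $f$ viewed as a bijection onto its range, and $f(D)$ carries the (norm) subspace topology of $Z$. Basic Hypothesis: the polynomial $p(x)=x^m-\alpha_{m-1}x^{m-1}-\cdots-\alpha_1x-\alpha_0$ has a unique positive root, which is simple and equal to $1$, and every other (complex) root has modulus strictly less than $1$. *)

theory Defs
  imports "HOL-Analysis.Analysis" "HOL-Computational_Algebra.Polynomial"
begin

text \<open>The coefficients \<open>\<alpha>\<^sub>0, \<dots>, \<alpha>\<^sub>m\<^sub>-\<^sub>1\<close> are the values of \<open>\<alpha> :: nat \<Rightarrow> real\<close> on \<open>{..<m}\<close>;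
  all other values of \<open>\<alpha>\<close> are irrelevant.\<close>

definition rec_poly :: "nat \<Rightarrow> (nat \<Rightarrow> real) \<Rightarrow> real poly" where
  "rec_poly m \<alpha> = monom 1 m - (\<Sum>i<m. monom (\<alpha> i) i)"

definition basic_hypothesis :: "nat \<Rightarrow> (nat \<Rightarrow> real) \<Rightarrow> bool" where
  "basic_hypothesis m \<alpha> \<longleftrightarrow>
     (\<forall>x::real. (x > 0 \<and> poly (rec_poly m \<alpha>) x = 0) \<longleftrightarrow> x = 1) \<and>
     order 1 (rec_poly m \<alpha>) = 1 \<and>
     (\<forall>z::complex. poly (map_poly complex_of_real (rec_poly m \<alpha>)) z = 0 \<and> z \<noteq> 1
        \<longrightarrow> cmod z < 1)"

definition partial_weight :: "(nat \<Rightarrow> real) \<Rightarrow> nat \<Rightarrow> real" where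
  "partial_weight \<alpha> k = (\<Sum>i\<le>k. \<alpha> i)"

definition limit_weight :: "nat \<Rightarrow> (nat \<Rightarrow> real) \<Rightarrow> nat \<Rightarrow> real" where
  "limit_weight m \<alpha> k = partial_weight \<alpha> k / (\<Sum>i<m. partial_weight \<alpha> i)"

text \<open>The sequence \<open>y\<close> starts with \<open>y0 0, \<dots>, y0 (m - 1)\<close> and obeys the recurrence. Since
  \<^const>\<open>inv_into\<close> is total, being a legitimate argument of \<open>f\<^sup>-\<^sup>1 : f(D) \<rightarrow> D\<close> is required
  explicitly at each step; well-definedness of the recurrence is thus the unique existence
  of such a \<open>y\<close>.\<close>

definition recurrence_seq ::
  "nat \<Rightarrow> (nat \<Rightarrow> real) \<Rightarrow> 'd topology \<Rightarrow> ('d \<Rightarrow> 'z::real_vector) \<Rightarrow> (nat \<Rightarrow> 'd) \<Rightarrow> (nat \<Rightarrow> 'd) \<Rightarrow> bool"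
  where
  "recurrence_seq m \<alpha> D f y0 y \<longleftrightarrow>
     (\<forall>k<m. y k = y0 k) \<and>
     (\<forall>n\<ge>m. (\<Sum>i<m. \<alpha> i *\<^sub>R f (y (n - m + i))) \<in> f ` topspace D \<and>
            y n = inv_into (topspace D) f (\<Sum>i<m. \<alpha> i *\<^sub>R f (y (n - m + i))))"

end

theory Submission
  imports Defs "HOL-Computational_Algebra.Fundamental_Theorem_Algebra"
begin

text \<open>
  Put \<open>z n = f (y n)\<close>. In the range of \<open>f\<close> the recurrence is linear:
  \<open>z (n + m) = (\<Sum>i<m. \<alpha> i *\<^sub>R z (n + i))\<close>. The right-hand side is a convex combination of
  earlier terms, so every term stays in the convex hull of the first \<open>m\<close> terms, which is
  contained in the convex set \<open>f ` topspace D\<close>; hence the inverse of \<open>f\<close> can always be applied.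

  For the convergence, every vector solution is a combination of its initial vectors whose
  coefficients are real solutions (\<open>solution_as_combination\<close>), so it is enough to treat real
  sequences \<open>x\<close>. The recurrence says that the polynomial \<^term>\<open>rec_poly m \<alpha>\<close>, evaluated at the
  shift operator, annihilates \<open>x\<close>. As \<open>1\<close> is a simple root, this polynomial is
  \<open>[:-1, 1:] * q\<close> where all complex roots of \<open>q\<close> lie in the open unit disc, and so \<open>q\<close>
  annihilates the difference sequence of \<open>x\<close>. If \<open>\<bar>\<zeta>\<bar> < 1\<close> and \<open>d (n + 1) - \<zeta> * d n\<close> is absolutely
  summable, then so is \<open>d\<close>; removing the roots of \<open>q\<close> one at a time therefore shows that the
  differences of \<open>x\<close> are absolutely summable (\<open>summable_of_shift_apply\<close>), and \<open>x\<close> converges.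

  The limit is read off from a conserved quantity: with the partial sums
  \<open>a k = (\<Sum>i\<le>k. \<alpha> i)\<close>, the vector \<open>\<Sum>k<m. a k *\<^sub>R z (n + k)\<close> does not depend on \<open>n\<close>
  (\<open>weighted_window_invariant\<close>). Letting \<open>n\<close> tend to infinity compares it with
  \<open>\<Sum>k<m. a k\<close> times the limit. Finally, continuity of the inverse of \<open>f\<close> carries the limit
  over to \<open>D\<close>.
\<close>

section \<open>Polynomials in the shift operator\<close>

text \<open>The polynomial \<open>p\<close> evaluated at the shift operator \<open>x \<mapsto> (\<lambda>n. x (n + 1))\<close>, applied
  to \<open>x\<close>.\<close>

definition shift_apply :: "'a::comm_ring_1 poly \<Rightarrow> (nat \<Rightarrow> 'a) \<Rightarrow> nat \<Rightarrow> 'a" where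
  "shift_apply p x n = (\<Sum>i\<le>degree p. coeff p i * x (n + i))"

lemma shift_apply_eq_sum:
  assumes "degree p \<le> N"
  shows "shift_apply p x n = (\<Sum>i\<le>N. coeff p i * x (n + i))"
  unfolding shift_apply_def
  by (rule sum.mono_neutral_left) (use assms in \<open>auto simp: coeff_eq_0\<close>)

lemma shift_apply_linear_factor:
  fixes q :: "'a::comm_ring_1 poly"
  shows "shift_apply ([:-c, 1:] * q) x n = shift_apply q x (Suc n) - c * shift_apply q x n"
proof -
  let ?N = "Suc (degree q)"
  have eq: "[:-c, 1:] * q = pCons 0 q - smult c q"
    by simp
  have deg: "degree (pCons 0 q - smult c q) \<le> ?N"
    by (intro degree_diff_le degree_pCons_le) (use degree_smult_le[of c q] in simp)
  have "shift_apply ([:-c, 1:] * q) x n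
      = (\<Sum>i\<le>?N. coeff (pCons 0 q) i * x (n + i)) - (\<Sum>i\<le>?N. c * (coeff q i * x (n + i)))"
    unfolding eq shift_apply_eq_sum[OF deg]
    by (simp add: sum_subtractf[symmetric] algebra_simps del: sum.atMost_Suc)
  also have "(\<Sum>i\<le>?N. coeff (pCons 0 q) i * x (n + i)) = shift_apply q x (Suc n)"
    by (subst sum.atMost_Suc_shift) (simp add: shift_apply_def)
  also have "(\<Sum>i\<le>?N. c * (coeff q i * x (n + i))) = c * shift_apply q x n"
    by (subst shift_apply_eq_sum[of q ?N]) (simp_all add: sum_distrib_left del: sum.atMost_Suc)
  finally show ?thesis .
qed

lemma shift_apply_diff:
  "shift_apply q (\<lambda>n. x (Suc n) - x n) n = shift_apply q x (Suc n) - shift_apply q x n"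
  by (simp add: shift_apply_def sum_subtractf[symmetric] algebra_simps)

text \<open>The partial sums \<open>S N\<close> of \<open>\<lambda>n. norm (d n)\<close> satisfy
  \<open>S N \<le> S (N + 1) \<le> norm (d 0) + norm c * S N + E\<close>, where \<open>E\<close> is the sum of the norms of the
  hypothesis; since \<open>norm c < 1\<close>, this bounds \<open>S N\<close>.\<close>

lemma summable_of_first_order_recurrence:
  fixes d :: "nat \<Rightarrow> 'a::real_normed_div_algebra"
  assumes c: "norm c < 1"
    and e: "summable (\<lambda>n. norm (d (Suc n) - c * d n))"
  shows "summable (\<lambda>n. norm (d n))"
proof (rule summableI_nonneg_bounded)
  define E where "E = (\<Sum>n. norm (d (Suc n) - c * d n))"
  fix N
  let ?S = "\<Sum>n<N. norm (d n)"
  have "?S \<le> (\<Sum>n<Suc N. norm (d n))"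
    by simp
  also have "\<dots> = norm (d 0) + (\<Sum>n<N. norm (d (Suc n)))"
    by (rule sum.lessThan_Suc_shift)
  also have "(\<Sum>n<N. norm (d (Suc n))) \<le> (\<Sum>n<N. norm c * norm (d n) + norm (d (Suc n) - c * d n))"
  proof (rule sum_mono)
    fix n
    show "norm (d (Suc n)) \<le> norm c * norm (d n) + norm (d (Suc n) - c * d n)"
      using norm_triangle_ineq[of "c * d n" "d (Suc n) - c * d n"] by (simp add: norm_mult)
  qed
  also have "\<dots> = norm c * ?S + (\<Sum>n<N. norm (d (Suc n) - c * d n))"
    by (simp add: sum.distrib sum_distrib_left)
  also have "(\<Sum>n<N. norm (d (Suc n) - c * d n)) \<le> E"
    unfolding E_def by (rule sum_le_suminf[OF e]) auto
  finally have "(1 - norm c) * ?S \<le> norm (d 0) + E"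
    by (simp add: algebra_simps)
  then show "?S \<le> (norm (d 0) + E) / (1 - norm c)"
    using c by (simp add: field_simps)
qed simp

text \<open>Splitting off one root \<open>c\<close> of \<open>q = [:-c, 1:] * r\<close> turns the hypothesis into a first-order
  recurrence for \<open>shift_apply r d\<close>. The induction ends at a nonzero constant polynomial, where
  \<open>shift_apply\<close> is multiplication by that constant.\<close>

lemma summable_of_shift_apply:
  fixes q :: "complex poly"
  assumes "q \<noteq> 0"
    and "\<And>w. poly q w = 0 \<Longrightarrow> cmod w < 1"
    and "summable (\<lambda>n. norm (shift_apply q d n))"
  shows "summable (\<lambda>n. norm (d n))"
  using assms
proof (induction "degree q" arbitrary: q)
  case 0
  then obtain c where q: "q = [:c:]"
    by (metis degree_eq_zeroE)
  with 0 have "c \<noteq> 0"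
    by auto
  with 0 q show ?case
    by (simp add: shift_apply_def norm_mult summable_cmult_iff)
next
  case (Suc k)
  then have "\<not> constant (poly q)"
    by (simp add: constant_degree)
  then obtain c where c: "poly q c = 0"
    using fundamental_theorem_of_algebra by blast
  then obtain r where q: "q = [:-c, 1:] * r"
    by (metis poly_eq_0_iff_dvd dvdE)
  have r: "r \<noteq> 0"
    using Suc.prems(1) q by auto
  have "degree q = Suc (degree r)"
    unfolding q using r by (subst degree_mult_eq) auto
  then have k: "k = degree r"
    using Suc.hyps(2) by simp
  have "summable (\<lambda>n. norm (shift_apply r d n))"
  proof (rule summable_of_first_order_recurrence)
    show "cmod c < 1"
      using Suc.prems(2) c by blast
    show "summable (\<lambda>n. cmod (shift_apply r d (Suc n) - c * shift_apply r d n))"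
      using Suc.prems(3) unfolding q shift_apply_linear_factor .
  qed
  moreover have "cmod w < 1" if "poly r w = 0" for w
    using Suc.prems(2)[of w] that by (simp add: q)
  ultimately show ?case
    using Suc.hyps(1)[OF k r] by blast
qed

section \<open>Convergence of real solutions\<close>

lemma coeff_rec_poly:
  "coeff (rec_poly m \<alpha>) k = (if k = m then 1 else 0) - (if k < m then \<alpha> k else 0)"
  by (auto simp: rec_poly_def coeff_sum)

lemma degree_rec_poly: "degree (rec_poly m \<alpha>) = m"
  by (rule antisym) (auto intro!: degree_le le_degree simp: coeff_rec_poly)

lemma shift_apply_rec_poly:
  fixes x :: "nat \<Rightarrow> real"
  shows "shift_apply (map_poly complex_of_real (rec_poly m \<alpha>)) (\<lambda>n. complex_of_real (x n)) n
    = complex_of_real (x (n + m) - (\<Sum>i<m. \<alpha> i * x (n + i)))"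
proof -
  let ?p = "map_poly complex_of_real (rec_poly m \<alpha>)"
  have "shift_apply ?p (\<lambda>n. complex_of_real (x n)) n
      = complex_of_real (\<Sum>i\<le>m. coeff (rec_poly m \<alpha>) i * x (n + i))"
    by (subst shift_apply_eq_sum[of _ m])
      (simp_all add: degree_map_poly degree_rec_poly coeff_map_poly)
  also have "(\<Sum>i\<le>m. coeff (rec_poly m \<alpha>) i * x (n + i)) = x (n + m) - (\<Sum>i<m. \<alpha> i * x (n + i))"
    by (simp add: lessThan_Suc_atMost[symmetric] coeff_rec_poly sum_negf)
  finally show ?thesis .
qed

lemma real_solution_convergent:
  fixes x :: "nat \<Rightarrow> real"
  assumes bh: "basic_hypothesis m \<alpha>"
    and rec: "\<And>n. x (n + m) = (\<Sum>i<m. \<alpha> i * x (n + i))"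
  shows "convergent x"
proof -
  let ?p = "rec_poly m \<alpha>"
  let ?C = "map_poly complex_of_real"
  define d where "d n = complex_of_real (x (Suc n)) - complex_of_real (x n)" for n
  have ord: "order 1 ?p = 1"
    and roots: "\<And>z. poly (?C ?p) z = 0 \<Longrightarrow> z \<noteq> 1 \<Longrightarrow> cmod z < 1"
    using bh by (auto simp: basic_hypothesis_def)
  have "?p \<noteq> 0"
    using coeff_rec_poly[of m \<alpha> m] by auto
  from order_decomp[OF this, of 1] ord
  obtain q where q: "?p = [:-1, 1:] * q" "\<not> [:-1, 1:] dvd q"
    by auto
  have Cp: "?C ?p = [:-1, 1:] * ?C q"
  proof -
    have "?C ([:-1, 1:] * q) = ?C [:-1, 1:] * ?C q"
      by (rule poly_eqI) (simp add: coeff_map_poly coeff_mult del: mult_pCons_left)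
    then show ?thesis
      by (simp add: q(1) map_poly_pCons)
  qed
  have "poly q 1 \<noteq> 0"
    using q(2) by (simp add: poly_eq_0_iff_dvd)
  moreover have "poly (?C q) 1 = complex_of_real (poly q 1)"
    using degree_map_poly[of complex_of_real q] by (simp add: poly_altdef coeff_map_poly)
  ultimately have q1: "poly (?C q) 1 \<noteq> 0"
    by simp
  have "summable (\<lambda>n. norm (d n))"
  proof (rule summable_of_shift_apply[of "?C q"])
    show "?C q \<noteq> 0"
      using q1 by auto
    show "cmod w < 1" if "poly (?C q) w = 0" for w
    proof -
      have "w \<noteq> 1"
        using q1 that by auto
      moreover have "poly (?C ?p) w = 0"
        unfolding Cp using that by simp
      ultimately show ?thesis
        by (rule roots[rotated])
    qed
    have "shift_apply (?C q) d n = shift_apply (?C ?p) (\<lambda>n. complex_of_real (x n)) n" for n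
      unfolding Cp shift_apply_linear_factor d_def
        shift_apply_diff[of _ "\<lambda>n. complex_of_real (x n)"]
      by simp
    then show "summable (\<lambda>n. norm (shift_apply (?C q) d n))"
      by (simp add: shift_apply_rec_poly rec)
  qed
  moreover have "norm (d n) = \<bar>x (Suc n) - x n\<bar>" for n
    unfolding d_def by (simp flip: of_real_diff)
  ultimately have "summable (\<lambda>n. x (Suc n) - x n)"
    using summable_rabs_cancel by auto
  then have "(\<lambda>n. \<Sum>k<n. x (Suc k) - x k) \<longlonglongrightarrow> (\<Sum>k. x (Suc k) - x k)"
    by (rule summable_LIMSEQ)
  then have "(\<lambda>n. (x n - x 0) + x 0) \<longlonglongrightarrow> (\<Sum>k. x (Suc k) - x k) + x 0"
    unfolding sum_lessThan_telescope by (intro tendsto_intros)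
  then show ?thesis
    by (auto simp: convergent_def)
qed

section \<open>Solutions in a Banach space\<close>

text \<open>An arbitrary function of the window of \<open>m\<close> preceding terms is allowed as \<open>step\<close>, so that the
  same recursion gives both the nonlinear sequence in \<open>D\<close> and the real fundamental solutions
  of the linear recurrence.\<close>

fun window_rec :: "nat \<Rightarrow> ('a list \<Rightarrow> 'a) \<Rightarrow> (nat \<Rightarrow> 'a) \<Rightarrow> nat \<Rightarrow> 'a" where
  "window_rec m step init n =
     (if n < m then init n else step (map (\<lambda>i. window_rec m step init (n - m + i)) [0..<m]))"

declare window_rec.simps [simp del]

lemma window_rec_init: "n < m \<Longrightarrow> window_rec m step init n = init n"
  by (simp add: window_rec.simps)

lemma window_rec_step:
  "n \<ge> m \<Longrightarrow>
    window_rec m step init n = step (map (\<lambda>i. window_rec m step init (n - m + i)) [0..<m])"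
  by (subst window_rec.simps) simp

text \<open>The coefficient \<open>c k\<close> is the fundamental solution whose \<open>k\<close>-th initial value is \<open>1\<close> and whose
  other initial values are \<open>0\<close>. It depends only on \<open>m\<close> and \<open>\<alpha>\<close>, and being real it reduces
  convergence in a Banach space to the scalar case.\<close>

lemma solution_as_combination:
  fixes z :: "nat \<Rightarrow> 'z::real_vector"
  assumes rec: "\<And>n. z (n + m) = (\<Sum>i<m. \<alpha> i *\<^sub>R z (n + i))"
  obtains c :: "nat \<Rightarrow> nat \<Rightarrow> real"
  where "\<And>k n. c k (n + m) = (\<Sum>i<m. \<alpha> i * c k (n + i))"
    and "\<And>n. z n = (\<Sum>k<m. c k n *\<^sub>R z k)"
proof -
  define c :: "nat \<Rightarrow> nat \<Rightarrow> real" where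
    "c k = window_rec m (\<lambda>xs. \<Sum>i<m. \<alpha> i * xs ! i) (\<lambda>j. if j = k then 1 else 0)" for k
  have c_rec: "c k (n + m) = (\<Sum>i<m. \<alpha> i * c k (n + i))" for k n
    unfolding c_def by (subst window_rec_step) auto
  have "z n = (\<Sum>k<m. c k n *\<^sub>R z k)" for n
  proof (induction n rule: less_induct)
    case (less n)
    show ?case
    proof (cases "n < m")
      case True
      then have "(\<Sum>k<m. c k n *\<^sub>R z k) = (\<Sum>k<m. if k = n then z k else 0)"
        by (intro sum.cong) (auto simp: c_def window_rec_init)
      with True show ?thesis
        by simp
    next
      case False
      define j where "j = n - m"
      have n: "n = j + m"
        using False by (simp add: j_def)
      have "z n = (\<Sum>i<m. \<alpha> i *\<^sub>R z (j + i))"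
        unfolding n by (rule rec)
      also have "\<dots> = (\<Sum>i<m. \<alpha> i *\<^sub>R (\<Sum>k<m. c k (j + i) *\<^sub>R z k))"
        by (intro sum.cong refl) (use less n in auto)
      also have "\<dots> = (\<Sum>k<m. \<Sum>i<m. (\<alpha> i * c k (j + i)) *\<^sub>R z k)"
        by (simp add: scaleR_sum_right) (rule sum.swap)
      also have "\<dots> = (\<Sum>k<m. c k n *\<^sub>R z k)"
        by (simp add: n c_rec scaleR_sum_left)
      finally show ?thesis .
    qed
  qed
  with c_rec that show thesis
    by blast
qed

lemma solution_convergent:
  fixes z :: "nat \<Rightarrow> 'z::real_normed_vector"
  assumes bh: "basic_hypothesis m \<alpha>"
    and rec: "\<And>n. z (n + m) = (\<Sum>i<m. \<alpha> i *\<^sub>R z (n + i))"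
  shows "convergent z"
proof -
  obtain c :: "nat \<Rightarrow> nat \<Rightarrow> real"
    where c: "\<And>k n. c k (n + m) = (\<Sum>i<m. \<alpha> i * c k (n + i))"
      and z: "\<And>n. z n = (\<Sum>k<m. c k n *\<^sub>R z k)"
    using solution_as_combination[of z m \<alpha>, OF rec] by blast
  have "c k \<longlonglongrightarrow> lim (c k)" for k
    using real_solution_convergent[of m \<alpha> "c k", OF bh c] by (simp only: convergent_LIMSEQ_iff)
  then have "(\<lambda>n. \<Sum>k<m. c k n *\<^sub>R z k) \<longlonglongrightarrow> (\<Sum>k<m. lim (c k) *\<^sub>R z k)"
    by (intro tendsto_intros)
  moreover have "(\<lambda>n. \<Sum>k<m. c k n *\<^sub>R z k) = z"
    by (rule ext) (rule z[symmetric])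
  ultimately have "z \<longlonglongrightarrow> (\<Sum>k<m. lim (c k) *\<^sub>R z k)"
    by (simp only:)
  then show ?thesis
    unfolding convergent_def by blast
qed

text \<open>Consecutive partial sums differ by a coefficient, so moving the window by one step changes
  the weighted sum by \<open>z (n + m) - (\<Sum>i<m. \<alpha> i *\<^sub>R z (n + i))\<close>: the total weight \<open>1\<close> is the one
  that meets the new term.\<close>

lemma weighted_window_invariant:
  fixes z :: "nat \<Rightarrow> 'z::real_vector"
  assumes one: "(\<Sum>i<m. \<alpha> i) = 1"
    and rec: "\<And>n. z (n + m) = (\<Sum>i<m. \<alpha> i *\<^sub>R z (n + i))"
  shows "(\<Sum>k<m. partial_weight \<alpha> k *\<^sub>R z (n + k)) = (\<Sum>k<m. partial_weight \<alpha> k *\<^sub>R z k)"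
proof (induction n)
  case (Suc n)
  have tel: "(\<Sum>k<M. partial_weight \<alpha> k *\<^sub>R z (Suc n + k))
      = (\<Sum>k<M. partial_weight \<alpha> k *\<^sub>R z (n + k)) + (\<Sum>k<M. \<alpha> k) *\<^sub>R z (n + M)
        - (\<Sum>k<M. \<alpha> k *\<^sub>R z (n + k))" for M
  proof (induction M)
    case (Suc M)
    have "partial_weight \<alpha> M = (\<Sum>k<M. \<alpha> k) + \<alpha> M"
      by (simp add: partial_weight_def lessThan_Suc_atMost[symmetric])
    with Suc show ?case
      by (simp add: algebra_simps)
  qed simp
  show ?case
    using tel[of m] Suc rec[of n] one by simp
qed simp

lemma partial_weight_nonneg:
  assumes "\<forall>i<m. \<alpha> i \<ge> 0" "k < m"
  shows "partial_weight \<alpha> k \<ge> 0"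
  unfolding partial_weight_def using assms by (intro sum_nonneg) auto

text \<open>The last partial sum is the full sum \<open>1\<close>.\<close>

lemma sum_partial_weight_pos:
  assumes nonneg: "\<forall>i<m. \<alpha> i \<ge> 0" and one: "(\<Sum>i<m. \<alpha> i) = 1"
  shows "(\<Sum>k<m. partial_weight \<alpha> k) > 0"
proof -
  obtain l where m: "m = Suc l"
    using one by (cases m) auto
  have "partial_weight \<alpha> l = 1"
    using one by (simp add: partial_weight_def m lessThan_Suc_atMost)
  moreover have "(\<Sum>k<l. partial_weight \<alpha> k) \<ge> 0"
    using partial_weight_nonneg[OF nonneg] by (intro sum_nonneg) (auto simp: m)
  ultimately show ?thesis
    by (simp add: m)
qed

lemma sum_limit_weight:
  fixes v :: "nat \<Rightarrow> 'z::real_vector"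
  shows "(\<Sum>k<m. limit_weight m \<alpha> k *\<^sub>R v k)
    = (\<Sum>k<m. partial_weight \<alpha> k *\<^sub>R v k) /\<^sub>R (\<Sum>k<m. partial_weight \<alpha> k)"
  by (simp add: limit_weight_def scaleR_sum_right divide_inverse mult.commute)

lemma solution_tendsto:
  fixes z :: "nat \<Rightarrow> 'z::real_normed_vector"
  assumes nonneg: "\<forall>i<m. \<alpha> i \<ge> 0" and one: "(\<Sum>i<m. \<alpha> i) = 1"
    and bh: "basic_hypothesis m \<alpha>"
    and rec: "\<And>n. z (n + m) = (\<Sum>i<m. \<alpha> i *\<^sub>R z (n + i))"
  shows "z \<longlonglongrightarrow> (\<Sum>k<m. limit_weight m \<alpha> k *\<^sub>R z k)"
proof -
  let ?A = "\<Sum>k<m. partial_weight \<alpha> k"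
  let ?W = "\<Sum>k<m. partial_weight \<alpha> k *\<^sub>R z k"
  obtain L where L: "z \<longlonglongrightarrow> L"
    using solution_convergent[OF bh rec] by (auto simp: convergent_def)
  have "(\<lambda>n. \<Sum>k<m. partial_weight \<alpha> k *\<^sub>R z (n + k)) \<longlonglongrightarrow> (\<Sum>k<m. partial_weight \<alpha> k *\<^sub>R L)"
    by (intro tendsto_intros LIMSEQ_ignore_initial_segment L)
  then have "(\<lambda>n::nat. ?W) \<longlonglongrightarrow> ?A *\<^sub>R L"
    by (simp add: weighted_window_invariant[OF one rec] scaleR_sum_left)
  then have "?W = ?A *\<^sub>R L"
    by (rule LIMSEQ_unique[OF tendsto_const])
  then have "(\<Sum>k<m. limit_weight m \<alpha> k *\<^sub>R z k) = L"
    unfolding sum_limit_weight using sum_partial_weight_pos[OF nonneg one] by simp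
  with L show ?thesis
    by simp
qed

section \<open>The recurrence through an injective map\<close>

text \<open>In this induction the legitimacy of \<^term>\<open>inv_into\<close> at each step is a conclusion: the convex
  combination lies in the hull, hence in the range of \<open>f\<close>. Accordingly the lemma serves both to
  construct the sequence and to describe every sequence obeying the recurrence.\<close>

lemma recurrence_stays_in_hull:
  fixes f :: "'d \<Rightarrow> 'z::real_vector" and y :: "nat \<Rightarrow> 'd"
  assumes nonneg: "\<forall>i<m. \<alpha> i \<ge> 0" and one: "(\<Sum>i<m. \<alpha> i) = 1"
    and conv: "convex (f ` S)"
    and init: "\<forall>k<m. y k \<in> S"
    and step: "\<And>n. n \<ge> m \<Longrightarrow> y n = inv_into S f (\<Sum>i<m. \<alpha> i *\<^sub>R f (y (n - m + i)))"
  defines "C \<equiv> convex hull ((\<lambda>k. f (y k)) ` {..<m})"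
  shows "y n \<in> S" and "f (y n) \<in> C"
    and "n \<ge> m \<Longrightarrow> (\<Sum>i<m. \<alpha> i *\<^sub>R f (y (n - m + i))) \<in> f ` S"
proof -
  have C_sub: "C \<subseteq> f ` S"
    unfolding C_def by (rule hull_minimal) (use init conv in auto)
  have comb: "(\<Sum>i<m. \<alpha> i *\<^sub>R f (y (n - m + i))) \<in> C"
    if "\<And>j. j < n \<Longrightarrow> f (y j) \<in> C" and "n \<ge> m" for n
    by (rule convex_sum) (use that nonneg one in \<open>auto simp: C_def\<close>)
  have main: "y n \<in> S \<and> f (y n) \<in> C" for n
  proof (induction n rule: less_induct)
    case (less n)
    show ?case
    proof (cases "n < m")
      case True
      with init show ?thesis
        unfolding C_def by (auto intro: hull_inc)
    next
      case False
      let ?v = "\<Sum>i<m. \<alpha> i *\<^sub>R f (y (n - m + i))"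
      have v: "?v \<in> C"
        using comb less False by simp
      with C_sub have "?v \<in> f ` S"
        by blast
      then show ?thesis
        using v step[of n] False inv_into_into[of ?v f S] f_inv_into_f[of ?v f S] by simp
    qed
  qed
  then show "y n \<in> S" and "f (y n) \<in> C"
    by blast+
  show "(\<Sum>i<m. \<alpha> i *\<^sub>R f (y (n - m + i))) \<in> f ` S" if "n \<ge> m"
    using comb[OF _ that] main C_sub by blast
qed

lemma recurrence_seq_unique:
  assumes "recurrence_seq m \<alpha> D f y0 y" "recurrence_seq m \<alpha> D f y0 y'"
  shows "y = y'"
proof
  fix n
  show "y n = y' n"
  proof (induction n rule: less_induct)
    case (less n)
    show ?case
    proof (cases "n < m")
      case True
      with assms show ?thesis
        by (simp add: recurrence_seq_def)
    next
      case False
      then have "(\<Sum>i<m. \<alpha> i *\<^sub>R f (y (n - m + i))) = (\<Sum>i<m. \<alpha> i *\<^sub>R f (y' (n - m + i)))"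
        by (intro sum.cong) (auto simp: less)
      with False assms show ?thesis
        by (simp add: recurrence_seq_def)
    qed
  qed
qed

lemma recurrence_seq_exists:
  fixes f :: "'d \<Rightarrow> 'z::real_vector"
  assumes nonneg: "\<forall>i<m. \<alpha> i \<ge> 0" and one: "(\<Sum>i<m. \<alpha> i) = 1"
    and conv: "convex (f ` topspace D)"
    and init: "\<forall>k<m. y0 k \<in> topspace D"
  shows "\<exists>y. recurrence_seq m \<alpha> D f y0 y"
proof -
  define y where
    "y = window_rec m (\<lambda>xs. inv_into (topspace D) f (\<Sum>i<m. \<alpha> i *\<^sub>R f (xs ! i))) y0"
  have y_init: "y k = y0 k" if "k < m" for k
    using that by (simp add: y_def window_rec_init)
  have y_step: "y n = inv_into (topspace D) f (\<Sum>i<m. \<alpha> i *\<^sub>R f (y (n - m + i)))" if "n \<ge> m" for n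
    unfolding y_def using that by (subst window_rec_step) auto
  have "(\<Sum>i<m. \<alpha> i *\<^sub>R f (y (n - m + i))) \<in> f ` topspace D" if "n \<ge> m" for n
    using recurrence_stays_in_hull(3)[OF nonneg one conv _ y_step that] init y_init by simp
  with y_init y_step show ?thesis
    unfolding recurrence_seq_def by blast
qed

theorem theorem5p1:
  fixes m :: nat and \<alpha> :: "nat \<Rightarrow> real"
    and D :: "'d topology" and f :: "'d \<Rightarrow> 'z::banach" and y0 :: "nat \<Rightarrow> 'd"
  assumes "m \<ge> 2"
    and "\<forall>i<m. \<alpha> i \<ge> 0"
    and "(\<Sum>i<m. \<alpha> i) = 1"
    and "topspace D \<noteq> {}"
    and "Hausdorff_space D"
    and "inj_on f (topspace D)"
    and "convex (f ` topspace D)"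
    and "\<forall>k<m. y0 k \<in> topspace D"
  shows
    "((\<exists>!y. recurrence_seq m \<alpha> D f y0 y) \<and>
      compact (convex hull ((\<lambda>k. f (y0 k)) ` {..<m})) \<and>
      convex (convex hull ((\<lambda>k. f (y0 k)) ` {..<m})) \<and>
      (\<forall>y. recurrence_seq m \<alpha> D f y0 y \<longrightarrow>
         (\<forall>n. y n \<in> topspace D \<and> f (y n) \<in> convex hull ((\<lambda>k. f (y0 k)) ` {..<m})))) \<and>
     (basic_hypothesis m \<alpha> \<and>
      continuous_map (top_of_set (f ` topspace D)) D (inv_into (topspace D) f) \<longrightarrow>
      (\<forall>y. recurrence_seq m \<alpha> D f y0 y \<longrightarrow>
         (\<Sum>k<m. limit_weight m \<alpha> k *\<^sub>R f (y k)) \<in> f ` topspace D \<and>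
         limitin D y
           (inv_into (topspace D) f (\<Sum>k<m. limit_weight m \<alpha> k *\<^sub>R f (y k))) sequentially \<and>
         inv_into (topspace D) f (\<Sum>k<m. limit_weight m \<alpha> k *\<^sub>R f (y k)) =
           inv_into (topspace D) f
             ((\<Sum>k<m. partial_weight \<alpha> k *\<^sub>R f (y k)) /\<^sub>R (\<Sum>k<m. partial_weight \<alpha> k)) \<and>
         inv_into (topspace D) f
             ((\<Sum>k<m. partial_weight \<alpha> k *\<^sub>R f (y k)) /\<^sub>R (\<Sum>k<m. partial_weight \<alpha> k)) =
           inv_into (topspace D) f
             ((\<Sum>k<m. \<Sum>i\<le>k. \<alpha> i *\<^sub>R f (y k)) /\<^sub>R (\<Sum>k<m. \<Sum>i\<le>k. \<alpha> i))))"
proof (intro conjI impI allI)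
  let ?S = "topspace D"
  let ?C = "convex hull ((\<lambda>k. f (y0 k)) ` {..<m})"
  note nonneg = assms(2) and one = assms(3) and conv = assms(7) and init = assms(8)
  show "\<exists>!y. recurrence_seq m \<alpha> D f y0 y"
    using recurrence_seq_exists[OF nonneg one conv init] recurrence_seq_unique by blast
  show "compact ?C"
    by (simp add: finite_imp_compact_convex_hull)
  show "convex ?C"
    by simp
  have stay: "y n \<in> ?S" "f (y n) \<in> ?C" if y: "recurrence_seq m \<alpha> D f y0 y" for y n
  proof -
    have y_init: "\<forall>k<m. y k \<in> ?S"
      using y init by (simp add: recurrence_seq_def)
    have step: "\<And>n. n \<ge> m \<Longrightarrow> y n = inv_into ?S f (\<Sum>i<m. \<alpha> i *\<^sub>R f (y (n - m + i)))"
      using y unfolding recurrence_seq_def by blast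
    note hull = recurrence_stays_in_hull[OF nonneg one conv y_init step]
    show "y n \<in> ?S"
      by (rule hull(1))
    have "(\<lambda>k. f (y k)) ` {..<m} = (\<lambda>k. f (y0 k)) ` {..<m}"
      using y by (intro image_cong) (auto simp: recurrence_seq_def)
    then show "f (y n) \<in> ?C"
      using hull(2)[of n] by simp
  qed
  show "y n \<in> ?S" "f (y n) \<in> ?C" if "recurrence_seq m \<alpha> D f y0 y" for y n
    using stay[OF that] .
  fix y
  assume hyp: "basic_hypothesis m \<alpha> \<and> continuous_map (top_of_set (f ` ?S)) D (inv_into ?S f)"
    and y: "recurrence_seq m \<alpha> D f y0 y"
  let ?L = "\<Sum>k<m. limit_weight m \<alpha> k *\<^sub>R f (y k)"
  have pos: "(\<Sum>k<m. partial_weight \<alpha> k) > 0"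
    by (rule sum_partial_weight_pos[OF nonneg one])
  show L_in: "?L \<in> f ` ?S"
  proof (rule convex_sum[OF _ conv])
    show "(\<Sum>k<m. limit_weight m \<alpha> k) = 1"
      using pos by (simp add: limit_weight_def flip: sum_divide_distrib)
    show "limit_weight m \<alpha> k \<ge> 0" if "k \<in> {..<m}" for k
      using that pos partial_weight_nonneg[OF nonneg] by (simp add: limit_weight_def)
  qed (use stay(1)[OF y] in auto)
  have rec: "f (y (n + m)) = (\<Sum>i<m. \<alpha> i *\<^sub>R f (y (n + i)))" for n
  proof -
    have "m \<le> n + m"
      by simp
    with y have "(\<Sum>i<m. \<alpha> i *\<^sub>R f (y (n + m - m + i))) \<in> f ` ?S \<and>
        y (n + m) = inv_into ?S f (\<Sum>i<m. \<alpha> i *\<^sub>R f (y (n + m - m + i)))"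
      unfolding recurrence_seq_def by blast
    then show ?thesis
      by (simp add: f_inv_into_f)
  qed
  have "(\<lambda>n. f (y n)) \<longlonglongrightarrow> ?L"
    by (rule solution_tendsto[OF nonneg one _ rec]) (use hyp in blast)
  then have "limitin (top_of_set (f ` ?S)) (\<lambda>n. f (y n)) ?L sequentially"
    using L_in stay(1)[OF y] by (simp add: limitin_subtopology)
  then have "limitin D (inv_into ?S f \<circ> (\<lambda>n. f (y n))) (inv_into ?S f ?L) sequentially"
    using hyp by (blast intro: continuous_map_limit)
  moreover have "inv_into ?S f \<circ> (\<lambda>n. f (y n)) = y"
    using stay(1)[OF y] assms(6) by auto
  ultimately show "limitin D y (inv_into ?S f ?L) sequentially"
    by simp
  show "inv_into ?S f ?L = inv_into ?S f
      ((\<Sum>k<m. partial_weight \<alpha> k *\<^sub>R f (y k)) /\<^sub>R (\<Sum>k<m. partial_weight \<alpha> k))"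
    by (simp only: sum_limit_weight)
  show "inv_into ?S f
      ((\<Sum>k<m. partial_weight \<alpha> k *\<^sub>R f (y k)) /\<^sub>R (\<Sum>k<m. partial_weight \<alpha> k)) =
    inv_into ?S f
      ((\<Sum>k<m. \<Sum>i\<le>k. \<alpha> i *\<^sub>R f (y k)) /\<^sub>R (\<Sum>k<m. \<Sum>i\<le>k. \<alpha> i))"
    by (simp add: partial_weight_def scaleR_sum_left)
qed

end
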